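(* Let $n \geq 1$. The only continuous unoriented Kakeya line set in $\mathbb{R}^n$ is $\mathbb{R}^n$ itself; that is, for every continuous map $\sigma: \mathbb{R}P^{n-1} \to \mathbb{R}^n$, $$|\sigma| = \bigcup_{L \in \mathbb{R}P^{n-1}} (\sigma(L) + L) = \mathbb{R}^n.$$
   Context: $\mathbb{R}P^{n-1}$ is the real projective space of lines (one-dimensional linear subspaces) $L$ through the origin in $\mathbb{R}^n$, with its usual topology. A continuous unoriented Kakeya line configuration in $\mathbb{R}^n$ is a continuous map $\sigma: \mathbb{R}P^{n-1} \to \mathbb{R}^n$; its underlying space is $|\sigma| = \bigcup_{L \in \mathbb{R}P^{n-1}} (\sigma(L)+L)$, where $\sigma(L)+L$ is the affine line through $\sigma(L)$ parallel to $L$. A continuous unoriented Kakeya line set is a subset of $\mathbb{R}^n$ that contains $|\sigma|$ for some continuous unoriented Kakeya line configuration $\sigma$. *)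

theory Defs
  imports "HOL-Analysis.Analysis"
begin

definition lines_through_origin :: "(real ^ 'n) set set" where
  "lines_through_origin = {L. subspace L \<and> dim L = 1}"

(* The usual topology on projective space: the quotient topology induced by the
   map x |-> span {x} from the nonzero vectors onto the lines through the origin. *)
definition projective_space :: "(real ^ 'n) set topology" where
  "projective_space =
     topology (\<lambda>U. U \<subseteq> lines_through_origin \<and>
       openin (top_of_set (UNIV - {0})) {x \<in> UNIV - {0}. span {x} \<in> U})"

lemma span_singleton_image_lines:
  "(\<lambda>x. span {x}) ` (UNIV - {0 :: real ^ 'n}) = lines_through_origin"
proof
  show "(\<lambda>x. span {x}) ` (UNIV - {0 :: real ^ 'n}) \<subseteq> lines_through_origin"
    by (auto simp: lines_through_origin_def)
next
  show "lines_through_origin \<subseteq> (\<lambda>x. span {x}) ` (UNIV - {0 :: real ^ 'n})"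
  proof
    fix L :: "(real ^ 'n) set"
    assume "L \<in> lines_through_origin"
    then have L: "subspace L" "dim L = 1"
      by (auto simp: lines_through_origin_def)
    obtain x where x: "x \<in> L" "x \<noteq> 0"
      using L by (metis dim_eq_0 subsetI singleton_iff zero_neq_one)
    have "span {x} \<subseteq> L"
      using x L by (simp add: span_minimal)
    moreover have "dim (span {x}) = dim L"
      using x L by simp
    ultimately have "span {x} = L"
      using L by (metis order_refl subspace_dim_equal subspace_span)
    then show "L \<in> (\<lambda>x. span {x}) ` (UNIV - {0})"
      using x by blast
  qed
qed

lemma openin_projective_space:
  "openin projective_space U \<longleftrightarrow>
     U \<subseteq> lines_through_origin \<and>
     openin (top_of_set (UNIV - {0})) {x \<in> UNIV - {0 :: real ^ 'n}. span {x} \<in> U}"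
proof -
  let ?P = "\<lambda>U. {x \<in> UNIV - {0 :: real ^ 'n}. span {x} \<in> U}"
  have int: "?P (S \<inter> T) = ?P S \<inter> ?P T" for S T by blast
  have un: "?P (\<Union>K) = \<Union> (?P ` K)" for K by blast
  have "istopology (\<lambda>U. U \<subseteq> lines_through_origin \<and> openin (top_of_set (UNIV - {0})) (?P U))"
    unfolding istopology_def int un by (blast intro: openin_Int openin_Union)
  then show ?thesis
    by (simp add: projective_space_def topology_inverse')
qed

lemma topspace_projective_space [simp]:
  "topspace projective_space = (lines_through_origin :: (real ^ 'n) set set)"
proof -
  have "{x \<in> UNIV - {0 :: real ^ 'n}. span {x} \<in> lines_through_origin} = UNIV - {0}"
    using span_singleton_image_lines by blast
  then have "openin projective_space (lines_through_origin :: (real ^ 'n) set set)"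
    by (simp add: openin_projective_space)
  then show ?thesis
    by (metis openin_projective_space openin_subset openin_topspace subset_antisym)
qed

lemma quotient_map_projective_space:
  "quotient_map (top_of_set (UNIV - {0 :: real ^ 'n})) projective_space (\<lambda>x. span {x})"
  by (simp add: quotient_map_def span_singleton_image_lines openin_projective_space)

definition unoriented_kakeya_line_configuration :: "((real ^ 'n) set \<Rightarrow> real ^ 'n) \<Rightarrow> bool" where
  "unoriented_kakeya_line_configuration \<sigma> \<longleftrightarrow> continuous_map projective_space euclidean \<sigma>"

definition underlying_space :: "((real ^ 'n) set \<Rightarrow> real ^ 'n) \<Rightarrow> (real ^ 'n) set" where
  "underlying_space \<sigma> = (\<Union>L\<in>lines_through_origin. (\<lambda>v. \<sigma> L + v) ` L)"

definition unoriented_kakeya_line_set :: "(real ^ 'n) set \<Rightarrow> bool" where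
  "unoriented_kakeya_line_set K \<longleftrightarrow> (\<exists>\<sigma>. unoriented_kakeya_line_configuration \<sigma> \<and> underlying_space \<sigma> \<subseteq> K)"

end

theory Submission
  imports Defs "HOL-Homology.Homology"
begin

text \<open>
  If \<open>p\<close> lies on none of the lines \<open>\<sigma>(L) + L\<close>, then projecting \<open>\<sigma>(span x) - p\<close> to the orthogonal
  complement of \<open>x\<close> gives a nowhere vanishing tangent field \<open>f\<close> on the unit sphere with
  \<open>f(-x) = f(x)\<close>. Being tangent, \<open>f / |f|\<close> is homotopic to the identity along line segments, so it
  has degree 1. But even maps have even degree: after approximation by an even polynomial the map
  takes the equator into a punctured, hence contractible, sphere, and modulo that set the two
  hemispheres have the same image up to sign.
\<close>

section \<open>Degree of even self-maps of \<open>nsphere n\<close>\<close>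

abbreviation (input) antipode :: "(nat \<Rightarrow> real) \<Rightarrow> nat \<Rightarrow> real"
  where "antipode \<equiv> \<lambda>x i. - x i"

lemma continuous_map_nsphere_antipode:
  "continuous_map (nsphere n) (nsphere n) antipode"
proof -
  have "continuous_map (nsphere n) euclideanreal (\<lambda>x. - x k)" for k
    by (intro continuous_map_minus continuous_map_nsphere_projection)
  then show ?thesis
    by (subst (2) nsphere)
       (force simp: continuous_map_in_subtopology continuous_map_componentwise_UNIV nsphere)
qed

text \<open>The map is its own inverse. A homeomorphism has degree 1 or -1, and the parity argument
  works with either sign.\<close>

lemma homeomorphic_map_nsphere_antipode:
  "homeomorphic_map (nsphere n) (nsphere n) antipode"
  unfolding homeomorphic_map_maps homeomorphic_maps_def
  by (rule exI [where x = antipode]) (simp add: continuous_map_nsphere_antipode)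

text \<open>The exact sequences of the triples formed by the sphere, one hemisphere and the equator
  run through the same middle group. Each hemisphere modulo the equator is isomorphic to the sphere
  modulo the opposite hemisphere, and these isomorphisms split the middle group as a direct
  sum.\<close>

lemma iso_relative_homology_group_equator_hemispheres:
  fixes p :: int and k :: nat
  defines "E \<equiv> {x::nat \<Rightarrow> real. x k = 0}"
  shows "(\<lambda>(x, y). hom_induced p (subtopology (nsphere n) {x. x k \<le> 0}) E (nsphere n) E id x
          \<otimes>\<^bsub>relative_homology_group p (nsphere n) E\<^esub>
          hom_induced p (subtopology (nsphere n) {x. x k \<ge> 0}) E (nsphere n) E id y)
        \<in> iso (relative_homology_group p (subtopology (nsphere n) {x. x k \<le> 0}) E \<times>\<times>
               relative_homology_group p (subtopology (nsphere n) {x. x k \<ge> 0}) E)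
              (relative_homology_group p (nsphere n) E)"
proof (rule conjunct1 [OF exact_sequence_sum_lemma])
  let ?l = "{x::nat \<Rightarrow> real. x k \<le> 0}" and ?u = "{x::nat \<Rightarrow> real. x k \<ge> 0}"
  show "hom_induced p (subtopology (nsphere n) ?l) E (nsphere n) ?u id
    \<in> iso (relative_homology_group p (subtopology (nsphere n) ?l) E) (relative_homology_group p (nsphere n) ?u)"
    unfolding E_def by (rule iso_relative_homology_group_lower_hemisphere)
  show "hom_induced p (subtopology (nsphere n) ?u) E (nsphere n) ?l id
    \<in> iso (relative_homology_group p (subtopology (nsphere n) ?u) E) (relative_homology_group p (nsphere n) ?l)"
    unfolding E_def by (rule iso_relative_homology_group_upper_hemisphere)
  show "exact_seq
     ([relative_homology_group p (nsphere n) ?l, relative_homology_group p (nsphere n) E,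
       relative_homology_group p (subtopology (nsphere n) ?l) E],
      [hom_induced p (nsphere n) E (nsphere n) ?l id,
       hom_induced p (subtopology (nsphere n) ?l) E (nsphere n) E id])"
    by (rule homology_exactness_triple_3) (auto simp: E_def)
  show "exact_seq
     ([relative_homology_group p (nsphere n) ?u, relative_homology_group p (nsphere n) E,
       relative_homology_group p (subtopology (nsphere n) ?u) E],
      [hom_induced p (nsphere n) E (nsphere n) ?u id,
       hom_induced p (subtopology (nsphere n) ?u) E (nsphere n) E id])"
    by (rule homology_exactness_triple_3) (auto simp: E_def)
qed (auto simp: hom_induced_compose' E_def Pi_iff)

text \<open>
  With \<open>v\<close> the fundamental class, its image in the homology of the sphere modulo the equator is
  \<open>x + y\<close> with \<open>x\<close>, \<open>y\<close> carried by the two hemispheres. The antipodal map has degree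
  \<open>\<epsilon> = \<plusminus>1\<close> and swaps the hemispheres, hence carries \<open>x\<close> to \<open>\<epsilon> y\<close>; an even map therefore sends
  \<open>x + y\<close> to \<open>1 + \<epsilon>\<close> times the image of \<open>y\<close>.
\<close>
lemma even_Brouwer_degree2_even_map:
  assumes "n \<noteq> 0"
    and contf: "continuous_map (nsphere n) (nsphere n) f"
    and evenf: "\<And>x. x \<in> topspace (nsphere n) \<Longrightarrow> f (antipode x) = f x"
    and fC: "\<And>x. \<lbrakk>x \<in> topspace (nsphere n); x n = 0\<rbrakk> \<Longrightarrow> f x \<in> C"
    and C: "contractible_space (subtopology (nsphere n) C)"
  shows "even (Brouwer_degree2 n f)"
proof -
  \<comment> \<open>The equator is cut down to the sphere because \<open>fC\<close> controls
    \<open>f\<close> only at points of the sphere, and \<open>f\<close> has to be a map of pairs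
    into \<open>C\<close>.\<close>
  define E where "E \<equiv> {x \<in> topspace (nsphere n). x n = 0}"
  define lower where "lower \<equiv> subtopology (nsphere n) {x. x n \<le> 0}"
  define upper where "upper \<equiv> subtopology (nsphere n) {x. x n \<ge> 0}"
  let ?S = "nsphere n"
  let ?H = "homology_group n ?S"
  let ?GE = "relative_homology_group n ?S E"
  let ?GC = "relative_homology_group n ?S C"
  let ?L = "relative_homology_group n lower E"
  let ?U = "relative_homology_group n upper E"
  let ?il = "hom_induced n lower E ?S E id"
  let ?iu = "hom_induced n upper E ?S E id"
  let ?jE = "hom_induced n ?S {} ?S E id"
  let ?jC = "hom_induced n ?S {} ?S C id"
  let ?negE = "hom_induced n ?S E ?S E antipode"
  let ?fE = "hom_induced n ?S E ?S C f"
  define d where "d \<equiv> Brouwer_degree2 n f"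
  define \<epsilon> where "\<epsilon> \<equiv> Brouwer_degree2 n antipode"
  have contneg: "continuous_map ?S ?S antipode"
    by (rule continuous_map_nsphere_antipode)
  have negE: "antipode \<in> E \<rightarrow> E"
    using continuous_map_image_subset_topspace [OF contneg] by (auto simp: E_def)
  have fE: "f \<in> E \<rightarrow> C"
    using fC by (auto simp: E_def)
  have \<epsilon>: "\<epsilon> = 1 \<or> \<epsilon> = -1"
    using Brouwer_degree2_homeomorphic_map [OF homeomorphic_map_nsphere_antipode, of n]
    unfolding \<epsilon>_def by linarith
  have red: "reduced_homology_group n ?S = ?H"
    using \<open>n \<noteq> 0\<close> by (simp add: un_reduced_homology_group)
  \<comment> \<open>Relative homology sees only the part of the subset inside the space, so the
    hyperplane of the hemisphere lemma may be replaced by \<open>E\<close>.\<close>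
  have rel: "relative_homology_group n X {x. x n = 0} = relative_homology_group n X (topspace X \<inter> {x. x n = 0})"
    "hom_induced n X {x. x n = 0} Y {x. x n = 0} h =
     hom_induced n X (topspace X \<inter> {x. x n = 0}) Y (topspace Y \<inter> {x. x n = 0}) h"
    for X Y :: "(nat \<Rightarrow> real) topology" and h
    by (simp_all add: hom_induced_restrict relative_homology_group_restrict)
  have top: "topspace ?S \<inter> {x. x n = 0} = E" "topspace lower \<inter> {x. x n = 0} = E" "topspace upper \<inter> {x. x n = 0} = E"
    by (auto simp: E_def lower_def upper_def)
  have "(\<lambda>(x, y). ?il x \<otimes>\<^bsub>?GE\<^esub> ?iu y) \<in> iso (?L \<times>\<times> ?U) ?GE"
    using iso_relative_homology_group_equator_hemispheres [of n n n]
    by (simp only: rel top flip: lower_def upper_def)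
  then have im: "(\<lambda>(x, y). ?il x \<otimes>\<^bsub>?GE\<^esub> ?iu y) ` (carrier ?L \<times> carrier ?U) = carrier ?GE"
    and inj: "inj_on (\<lambda>(x, y). ?il x \<otimes>\<^bsub>?GE\<^esub> ?iu y) (carrier ?L \<times> carrier ?U)"
    by (simp_all add: iso_iff)
  have surj: "\<exists>x\<in>carrier ?L. \<exists>y\<in>carrier ?U. c = ?il x \<otimes>\<^bsub>?GE\<^esub> ?iu y" if "c \<in> carrier ?GE" for c
    using that unfolding im [symmetric] by auto
  interpret GE: comm_group ?GE by simp
  interpret GC: comm_group ?GC by simp
  interpret U: comm_group ?U by simp
  interpret L: comm_group ?L by simp
  interpret H: comm_group ?H by simp
  interpret il: group_hom ?L ?GE ?il
    by (simp add: group_hom_axioms_def group_hom_def hom_induced_hom)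
  interpret iu: group_hom ?U ?GE ?iu
    by (simp add: group_hom_axioms_def group_hom_def hom_induced_hom)
  interpret jE: group_hom ?H ?GE ?jE
    by (simp add: group_hom_axioms_def group_hom_def hom_induced_hom)
  interpret jC: group_hom ?H ?GC ?jC
    by (simp add: group_hom_axioms_def group_hom_def hom_induced_hom)
  interpret neg: group_hom ?GE ?GE ?negE
    by (simp add: group_hom_axioms_def group_hom_def hom_induced_hom)
  interpret f: group_hom ?GE ?GC ?fE
    by (simp add: group_hom_axioms_def group_hom_def hom_induced_hom)
  obtain v where v: "v \<in> carrier ?H" and vgen: "subgroup_generated ?H {v} = ?H"
    using cyclic_reduced_homology_group_nsphere [of n n] red by (auto simp: cyclic_group_def)
  obtain x y where x: "x \<in> carrier ?L" and y: "y \<in> carrier ?U"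
    and xy: "?jE v = ?il x \<otimes>\<^bsub>?GE\<^esub> ?iu y"
    using surj jE.hom_closed [OF v] by blast
  define x' where "x' \<equiv> hom_induced n lower E upper E antipode x"
  define y' where "y' \<equiv> hom_induced n upper E lower E antipode y"
  have x': "x' \<in> carrier ?U" and y': "y' \<in> carrier ?L"
    by (simp_all add: x'_def y'_def hom_induced_carrier)
  have contlu: "continuous_map lower upper antipode" "continuous_map upper lower antipode"
    using contneg by (auto simp: lower_def upper_def continuous_map_in_subtopology continuous_map_from_subtopology)
  have contid: "continuous_map lower ?S id" "continuous_map upper ?S id"
    by (auto simp: lower_def upper_def)
  have neg_il: "?negE (?il x) = ?iu x'"
    unfolding x'_def using contneg negE contlu contid by (simp add: hom_induced_compose' comp_def)
  have neg_iu: "?negE (?iu y) = ?il y'"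
    unfolding y'_def using contneg negE contlu contid by (simp add: hom_induced_compose' comp_def)
  have "?negE (?jE v) = ?jE (hom_induced n ?S {} ?S {} antipode v)"
    using contneg negE by (simp add: hom_induced_compose' comp_def)
  also have "\<dots> = ?jE v [^]\<^bsub>?GE\<^esub> \<epsilon>"
    using Brouwer_degree2 [of v n antipode] v by (simp add: red \<epsilon>_def jE.hom_int_pow)
  also have "\<dots> = ?il (x [^]\<^bsub>?L\<^esub> \<epsilon>) \<otimes>\<^bsub>?GE\<^esub> ?iu (y [^]\<^bsub>?U\<^esub> \<epsilon>)"
    using x y by (simp add: xy GE.int_pow_distrib il.hom_int_pow iu.hom_int_pow)
  finally have "?il y' \<otimes>\<^bsub>?GE\<^esub> ?iu x' = ?il (x [^]\<^bsub>?L\<^esub> \<epsilon>) \<otimes>\<^bsub>?GE\<^esub> ?iu (y [^]\<^bsub>?U\<^esub> \<epsilon>)"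
    using x y x' y' by (simp add: xy neg_il neg_iu GE.m_comm)
  \<comment> \<open>The sum over the two hemispheres is direct, so components can be compared. The
    groups are written multiplicatively: a power by \<epsilon> is the multiple by the
    degree.\<close>
  then have "(y', x') = (x [^]\<^bsub>?L\<^esub> \<epsilon>, y [^]\<^bsub>?U\<^esub> \<epsilon>)"
    by (intro inj_onD [OF inj]) (use x y x' y' in auto)
  then have x'y: "x' = y [^]\<^bsub>?U\<^esub> \<epsilon>"
    by simp
  have f_neg: "?fE (?negE c) = ?fE c" for c
  proof -
    have "?fE (?negE c) = hom_induced n ?S E ?S C (f \<circ> antipode) c"
      using contneg negE contf fE by (simp add: hom_induced_compose')
    also have "\<dots> = ?fE c"
      by (rule arg_cong [where f = "\<lambda>h. h c"], rule hom_induced_eq) (simp add: evenf)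
    finally show ?thesis .
  qed
  define w where "w \<equiv> ?fE (?iu y)"
  have w: "w \<in> carrier ?GC"
    by (simp add: w_def hom_induced_carrier)
  have "?jC v [^]\<^bsub>?GC\<^esub> d = ?jC (hom_induced n ?S {} ?S {} f v)"
    using Brouwer_degree2 [of v n f] v by (simp add: red d_def jC.hom_int_pow)
  also have "\<dots> = ?fE (?jE v)"
    using contf fE by (simp add: hom_induced_compose' comp_def)
  \<comment> \<open>By evenness of \<open>f\<close> the antipode may be inserted in front of
    \<open>?fE\<close>, which moves the lower contribution to the upper hemisphere.\<close>
  also have "\<dots> = ?fE (?negE (?il x)) \<otimes>\<^bsub>?GC\<^esub> w"
    using x y by (simp add: xy w_def f_neg)
  also have "\<dots> = w [^]\<^bsub>?GC\<^esub> \<epsilon> \<otimes>\<^bsub>?GC\<^esub> w"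
    using y by (simp add: neg_il x'y w_def iu.hom_int_pow f.hom_int_pow)
  finally have jd: "?jC v [^]\<^bsub>?GC\<^esub> d = w [^]\<^bsub>?GC\<^esub> (\<epsilon> + 1)"
    using w by (simp add: GC.int_pow_mult)
  \<comment> \<open>A point of the equator, available since \<open>n\<close> is positive. Its image
    shows that \<open>C\<close> meets the sphere, as the isomorphism modulo a contractible subset
    requires.\<close>
  have "(\<lambda>i. if i = 0 then 1 else 0) \<in> E"
    using in_topspace_nsphere \<open>n \<noteq> 0\<close> by (simp add: E_def)
  then have "topspace ?S \<inter> C \<noteq> {}"
    using fE continuous_map_image_subset_topspace [OF contf] by (fastforce simp: E_def)
  then have iso: "?jC \<in> iso ?H ?GC"
    using iso_reduced_homology_by_contractible [OF C] red by metis
  \<comment> \<open>Since \<open>?jC\<close> is an isomorphism, \<open>w\<close> comes from a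
    multiple of the generator \<open>v\<close>, and the equation modulo \<open>C\<close> lifts to
    the homology of the sphere.\<close>
  then obtain z where z: "z \<in> carrier ?H" "w = ?jC z"
    using w by (auto simp: iso_iff)
  obtain k :: int where k: "z = v [^]\<^bsub>?H\<^esub> k"
    using z(1) v vgen H.carrier_subgroup_generated_by_singleton [of v] by auto
  have "?jC (v [^]\<^bsub>?H\<^esub> d) = ?jC (v [^]\<^bsub>?H\<^esub> (k * (\<epsilon> + 1)))"
    using jd v by (simp add: z k jC.hom_int_pow GC.int_pow_pow)
  then have "v [^]\<^bsub>?H\<^esub> d = v [^]\<^bsub>?H\<^esub> (k * (\<epsilon> + 1))"
    using iso v by (auto simp: iso_iff inj_on_def)
  \<comment> \<open>The generator of an infinite cyclic group has infinite order, encoded as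
    \<open>ord\<close> 0, so equal powers have equal exponents. The factor
    \<open>\<epsilon> + 1\<close> is then 0 or 2.\<close>
  moreover have "infinite (carrier ?H)"
    using iso_finite [OF reduced_homology_group_nsphere(1) [of n]] by (simp add: red infinite_UNIV_int)
  then have "H.ord v = 0"
    using H.infinite_cyclic_subgroup_order [OF v] by (simp add: vgen)
  ultimately have "d = k * (\<epsilon> + 1)"
    using v by (simp add: H.int_pow_eq)
  then show ?thesis
    using \<epsilon> by (auto simp: d_def)
qed

section \<open>Passage to the unit sphere of a Euclidean space\<close>

lemma nsphere_eq_top_of_set:
  "nsphere n = top_of_set {x. (\<Sum>i\<le>n. (x i)\<^sup>2) = 1 \<and> (\<forall>i>n. x i = 0)}"
  by (simp add: nsphere euclidean_product_topology)

text \<open>Coordinates in an enumerated orthonormal basis give a linear identification. It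
  therefore respects antipodes and takes the equator to a hyperplane section, so evenness and the
  equator carry over between the two models.\<close>

lemma homeomorphic_maps_nsphere_sphere_linear:
  assumes n: "DIM('a::euclidean_space) = Suc n"
  obtains \<phi> :: "(nat \<Rightarrow> real) \<Rightarrow> 'a::euclidean_space" and \<psi> and b
  where "homeomorphic_maps (nsphere n) (top_of_set (sphere 0 1)) \<phi> \<psi>"
    and "\<And>x. \<phi> (\<lambda>i. - x i) = - \<phi> x" and "b \<in> Basis"
    and "\<And>x. \<phi> x \<bullet> b = x n"
proof -
  obtain b where b: "bij_betw b {..n} (Basis :: 'a set)"
    using n by (metis card_atMost finite_Basis finite_atMost finite_same_card_bij)
  have bB: "b i \<in> Basis" if "i \<le> n" for i
    using b that by (auto simp: bij_betw_def)
  have inner_b: "b i \<bullet> b j = (if i = j then 1 else 0)" if "i \<le> n" "j \<le> n" for i j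
    using bB that bij_betw_imp_inj_on [OF b] by (auto simp: inner_Basis inj_on_def)
  define \<phi> :: "(nat \<Rightarrow> real) \<Rightarrow> 'a" where "\<phi> \<equiv> \<lambda>x. \<Sum>i\<le>n. x i *\<^sub>R b i"
  \<comment> \<open>Points of \<open>nsphere n\<close> have \<open>n + 1\<close> free coordinates
    and vanish beyond index \<open>n\<close>, hence the default 0.\<close>
  define \<psi> :: "'a \<Rightarrow> nat \<Rightarrow> real" where "\<psi> \<equiv> \<lambda>v i. if i \<le> n then v \<bullet> b i else 0"
  have \<phi>_b: "\<phi> x \<bullet> b k = x k" if "k \<le> n" for x k
    using that by (simp add: \<phi>_def inner_sum_left inner_b if_distrib cong: if_cong)
  have Basis_b: "(\<Sum>i\<le>n. h (b i)) = sum h Basis" for h :: "'a \<Rightarrow> 'c::comm_monoid_add"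
    using sum.reindex_bij_betw [OF b] by blast
  have norm_sq: "(norm v)\<^sup>2 = (\<Sum>i\<le>n. (v \<bullet> b i)\<^sup>2)" for v
    using Basis_b [of "\<lambda>b. (v \<bullet> b)\<^sup>2"] euclidean_inner [of v v]
    by (simp only: power2_norm_eq_inner) (simp add: power2_eq_square)
  show thesis
  proof
    show "homeomorphic_maps (nsphere n) (top_of_set (sphere 0 1)) \<phi> \<psi>"
      unfolding homeomorphic_maps_def nsphere_eq_top_of_set
    proof (intro conjI ballI)
      show "continuous_map (top_of_set {x. (\<Sum>i\<le>n. (x i)\<^sup>2) = 1 \<and> (\<forall>i>n. x i = 0)}) (top_of_set (sphere 0 1)) \<phi>"
      proof (clarsimp, intro conjI)
        show "continuous_on {x. (\<Sum>i\<le>n. (x i)\<^sup>2) = 1 \<and> (\<forall>i>n. x i = 0)} \<phi>"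
          unfolding \<phi>_def
          by (intro continuous_intros continuous_on_subset [OF continuous_on_product_coordinates]) auto
        show "\<phi> \<in> {x. (\<Sum>i\<le>n. (x i)\<^sup>2) = 1 \<and> (\<forall>i>n. x i = 0)} \<rightarrow> sphere 0 1"
        proof clarsimp
          fix x :: "nat \<Rightarrow> real"
          assume "(\<Sum>i\<le>n. (x i)\<^sup>2) = 1"
          then have "(norm (\<phi> x))\<^sup>2 = 1"
            using norm_sq [of "\<phi> x"] by (simp add: \<phi>_b)
          then show "norm (\<phi> x) = 1"
            by (metis abs_norm_cancel abs_square_eq_1)
        qed
      qed
      show "continuous_map (top_of_set (sphere 0 1)) (top_of_set {x. (\<Sum>i\<le>n. (x i)\<^sup>2) = 1 \<and> (\<forall>i>n. x i = 0)}) \<psi>"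
      proof (clarsimp, intro conjI)
        show "continuous_on (sphere 0 1) \<psi>"
        proof (rule continuous_on_coordinatewise_then_product)
          show "continuous_on (sphere 0 1) (\<lambda>v. \<psi> v i)" for i
            by (cases "i \<le> n") (simp_all add: \<psi>_def continuous_on_inner)
        qed
        show "\<psi> \<in> sphere 0 1 \<rightarrow> {x. (\<Sum>i\<le>n. (x i)\<^sup>2) = 1 \<and> (\<forall>i>n. x i = 0)}"
          by (auto simp: \<psi>_def simp flip: norm_sq)
      qed
    qed (use \<phi>_b Basis_b [of "\<lambda>b. (v \<bullet> b) *\<^sub>R b" for v] in
          \<open>auto simp: \<psi>_def \<phi>_def euclidean_representation\<close>)
    show "\<phi> (\<lambda>i. - x i) = - \<phi> x" for x
      by (simp add: \<phi>_def sum_negf)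
    show "b n \<in> Basis" "\<And>x. \<phi> x \<bullet> b n = x n"
      using bB \<phi>_b by auto
  qed
qed

text \<open>Stereographic projection identifies the punctured sphere with a hyperplane, which is
  convex.\<close>

lemma contractible_punctured_sphere:
  fixes a :: "'a::euclidean_space"
  assumes "0 < r" "b \<in> sphere a r"
  shows "contractible (sphere a r - {b})"
proof -
  obtain c :: 'a where "c \<in> Basis"
    using nonempty_Basis by blast
  then have "sphere a r - {b} homeomorphic {x. c \<bullet> x = 0}"
    using assms by (intro homeomorphic_punctured_sphere_hyperplane) auto
  then show ?thesis
    by (metis convex_hyperplane convex_imp_contractible homeomorphic_contractible_eq)
qed

text \<open>The straight-line homotopy avoids 0, so it can be followed by radial projection, which
  fixes the unit vectors \<open>f x\<close>.\<close>

lemma homotopic_normalized_sphere_map: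
  fixes f g :: "'a::topological_space \<Rightarrow> 'b::real_normed_vector"
  assumes contf: "continuous_on S f" and contg: "continuous_on S g"
    and f: "\<And>x. x \<in> S \<Longrightarrow> norm (f x) = 1"
    and fg: "\<And>x. x \<in> S \<Longrightarrow> 0 \<notin> closed_segment (f x) (g x)"
  shows "homotopic_with_canon (\<lambda>x. True) S (sphere 0 1) f (\<lambda>x. g x /\<^sub>R norm (g x))"
proof -
  have "homotopic_with_canon (\<lambda>x. True) S (- {0}) f g"
    using fg by (intro homotopic_with_linear contf contg) auto
  then have "homotopic_with_canon (\<lambda>x. True) S (sphere 0 1)
      ((\<lambda>x. x /\<^sub>R norm x) \<circ> f) ((\<lambda>x. x /\<^sub>R norm x) \<circ> g)"
    by (rule homotopic_with_compose_continuous_left) (auto intro!: continuous_intros)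
  then show ?thesis
    by (rule homotopic_with_eq) (auto simp: f)
qed

section \<open>Even maps of the unit sphere are not homotopic to the identity\<close>

text \<open>Differentiability prevents the image of the equator from filling the sphere. The degree
  is then even, whereas the identity has degree 1.\<close>

lemma even_differentiable_sphere_map_not_homotopic_id:
  fixes f :: "'a::euclidean_space \<Rightarrow> 'a"
  assumes "2 \<le> DIM('a)"
    and difff: "f differentiable_on sphere 0 1"
    and evenf: "\<And>x. norm x = 1 \<Longrightarrow> f (- x) = f x"
    and hom: "homotopic_with_canon (\<lambda>x. True) (sphere 0 1) (sphere 0 1) id f"
  shows False
proof -
  obtain n where n: "DIM('a) = Suc n" "n \<noteq> 0"
    using assms(1) by (metis Suc_le_D Suc_1 Suc_le_mono le_zero_eq zero_neq_one One_nat_def)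
  obtain \<phi> :: "(nat \<Rightarrow> real) \<Rightarrow> 'a" and \<psi> and b
    where hm: "homeomorphic_maps (nsphere n) (top_of_set (sphere 0 1)) \<phi> \<psi>"
      and \<phi>_neg: "\<And>x. \<phi> (\<lambda>i. - x i) = - \<phi> x" and b: "b \<in> Basis" and \<phi>_b: "\<And>x. \<phi> x \<bullet> b = x n"
    using homeomorphic_maps_nsphere_sphere_linear [OF n(1)] by metis
  have cont\<phi>: "continuous_map (nsphere n) (top_of_set (sphere 0 1)) \<phi>"
    and cont\<psi>: "continuous_map (top_of_set (sphere 0 1)) (nsphere n) \<psi>"
    and \<psi>\<phi>: "\<And>x. x \<in> topspace (nsphere n) \<Longrightarrow> \<psi> (\<phi> x) = x"
    using hm by (auto simp: homeomorphic_maps_def)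
  have \<phi>1: "norm (\<phi> x) = 1" if "x \<in> topspace (nsphere n)" for x
    using cont\<phi> that by (auto simp: continuous_map_def)
  have fim: "norm (f x) = 1" if "norm x = 1" for x
    using homotopic_with_imp_subset2 [OF hom] that by (simp add: image_subset_iff)
  \<comment> \<open>A differentiable map cannot send the unit sphere of a proper subspace onto the
    whole unit sphere. The missed point \<open>p\<close> yields the contractible set for the parity
    lemma.\<close>
  have "f ` (sphere 0 1 \<inter> {x. b \<bullet> x = 0}) \<noteq> sphere 0 1 \<inter> UNIV"
  proof (rule spheremap_lemma1)
    have "b \<noteq> 0"
      using b by auto
    then show "dim {x. b \<bullet> x = 0} < dim (UNIV :: 'a set)"
      using n by (simp add: dim_hyperplane)
    show "f differentiable_on sphere 0 1 \<inter> {x. b \<bullet> x = 0}"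
      using difff by (rule differentiable_on_subset) auto
  qed (auto simp: subspace_hyperplane)
  then obtain p where p: "norm p = 1" "\<And>x. \<lbrakk>norm x = 1; b \<bullet> x = 0\<rbrakk> \<Longrightarrow> f x \<noteq> p"
    using fim by fastforce
  let ?g = "\<psi> \<circ> f \<circ> \<phi>"
  have "homotopic_with (\<lambda>x. True) (nsphere n) (nsphere n) (\<psi> \<circ> id \<circ> \<phi>) ?g"
    using cont\<phi> cont\<psi> hom
    by (intro homotopic_with_compose_continuous_map_right homotopic_with_compose_continuous_map_left) auto
  then have hom': "homotopic_with (\<lambda>x. True) (nsphere n) (nsphere n) id ?g"
    by (rule homotopic_with_eq) (auto simp: \<psi>\<phi>)
  have "even (Brouwer_degree2 n ?g)"
  proof (rule even_Brouwer_degree2_even_map)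
    show "continuous_map (nsphere n) (nsphere n) ?g"
      using hom' homotopic_with_imp_continuous_maps by blast
    show "?g (\<lambda>i. - x i) = ?g x" if "x \<in> topspace (nsphere n)" for x
      using that by (simp add: \<phi>_neg \<phi>1 evenf)
    show "?g x \<in> \<psi> ` (sphere 0 1 - {p})" if "x \<in> topspace (nsphere n)" "x n = 0" for x
      using p(2) [of "\<phi> x"] \<phi>_b [of x] that by (auto simp: \<phi>1 fim inner_commute)
    have "homeomorphic_map (top_of_set (sphere 0 1)) (nsphere n) \<psi>"
      using hm by (metis homeomorphic_maps_sym homeomorphic_map_maps)
    then have "homeomorphic_map (subtopology (top_of_set (sphere 0 1)) (sphere 0 1 - {p}))
        (subtopology (nsphere n) (\<psi> ` (sphere 0 1 - {p}))) \<psi>"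
      using continuous_map_image_subset_topspace [OF cont\<psi>]
      by (intro homeomorphic_map_subtopologies_alt) (auto simp: homeomorphic_eq_everything_map inj_on_def)
    then have "top_of_set (sphere 0 1 - {p}) homeomorphic_space subtopology (nsphere n) (\<psi> ` (sphere 0 1 - {p}))"
      by (metis homeomorphic_map_imp_homeomorphic_space subtopology_subtopology inf.absorb2 Diff_subset)
    then show "contractible_space (subtopology (nsphere n) (\<psi> ` (sphere 0 1 - {p})))"
      using contractible_punctured_sphere [of 1 p 0] p(1)
      by (simp flip: homeomorphic_space_contractibility)
  qed (fact n)
  then show False
    using Brouwer_degree2_homotopic [OF hom'] by simp
qed

text \<open>A homotopy leads from \<open>f\<close> to a normalized even polynomial map, which falls
  under the differentiable case.\<close>

lemma even_sphere_map_not_homotopic_id: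
  fixes f :: "'a::euclidean_space \<Rightarrow> 'a"
  assumes "2 \<le> DIM('a)"
    and evenf: "\<And>x. norm x = 1 \<Longrightarrow> f (- x) = f x"
  shows "\<not> homotopic_with_canon (\<lambda>x. True) (sphere 0 1) (sphere 0 1) id f"
proof
  assume hom: "homotopic_with_canon (\<lambda>x. True) (sphere 0 1) (sphere 0 1) id f"
  have contf: "continuous_on (sphere 0 1) f" and fim: "\<And>x. norm x = 1 \<Longrightarrow> norm (f x) = 1"
    using homotopic_with_imp_continuous [OF hom] homotopic_with_imp_subset2 [OF hom]
    by (simp_all add: image_subset_iff)
  obtain q where q: "polynomial_function q" and qf: "\<And>x. norm x = 1 \<Longrightarrow> norm (f x - q x) < 1"
    using Stone_Weierstrass_polynomial_function [OF compact_sphere contf zero_less_one] by auto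
  \<comment> \<open>The even part of \<open>q\<close>. As \<open>f\<close> is even, averaging over
    \<open>x\<close> and \<open>- x\<close> keeps the error below 1.\<close>
  define r where "r \<equiv> \<lambda>x. (1/2) *\<^sub>R (q x + q (- x))"
  have r: "polynomial_function r"
    using polynomial_function_compose [OF polynomial_function_minus [OF polynomial_function_id] q]
    unfolding r_def o_def by (intro polynomial_function_cmul polynomial_function_add q)
  have rf: "norm (f x - r x) < 1" if "norm x = 1" for x
  proof -
    have "f x - r x = (1/2) *\<^sub>R ((f x - q x) + (f (- x) - q (- x)))"
      using that by (simp add: r_def evenf algebra_simps flip: scaleR_add_left)
    also have "norm \<dots> \<le> (norm (f x - q x) + norm (f (- x) - q (- x))) / 2"
      by (simp add: norm_triangle_ineq)
    finally show ?thesis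
      using qf [of x] qf [of "- x"] that by simp
  qed
  \<comment> \<open>The error is smaller than the norm of \<open>f x\<close>, which is 1, so the
    segment cannot reach 0.\<close>
  have r0: "0 \<notin> closed_segment (f x) (r x)" if "norm x = 1" for x
  proof
    assume "0 \<in> closed_segment (f x) (r x)"
    then have "norm (f x) \<le> norm (r x - f x)"
      using segment_bound(1) by fastforce
    then show False
      using rf [OF that] fim [OF that] by (simp add: norm_minus_commute)
  qed
  let ?g = "\<lambda>x. r x /\<^sub>R norm (r x)"
  have contr: "continuous_on (sphere 0 1) r"
    using continuous_on_polymonial_function [OF r] .
  have hom': "homotopic_with_canon (\<lambda>x. True) (sphere 0 1) (sphere 0 1) id ?g"
    using homotopic_with_trans [OF hom homotopic_normalized_sphere_map [OF contf contr]] fim r0 by simp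
  have dr: "r differentiable_on sphere 0 1"
    by (rule differentiable_on_polynomial_function [OF r])
  have r_nz: "r x \<noteq> 0" if "norm x = 1" for x
    using r0 [OF that] ends_in_segment by metis
  have "norm differentiable_on r ` sphere 0 1"
    using r_nz by (intro differentiable_on_norm) (auto simp: image_iff)
  with dr have "?g differentiable_on sphere 0 1"
    using r_nz by (intro derivative_intros differentiable_on_compose [OF dr]) auto
  moreover have "?g (- x) = ?g x" for x
    by (simp add: r_def add.commute)
  ultimately show False
    using even_differentiable_sphere_map_not_homotopic_id [OF assms(1) _ _ hom'] by blast
qed

section \<open>From a point missed by all lines to an even tangent field\<close>

lemma underlying_space_eq_UNIV:
  fixes \<sigma> :: "(real ^ 'n) set \<Rightarrow> real ^ 'n"
  assumes "unoriented_kakeya_line_configuration \<sigma>"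
  shows "underlying_space \<sigma> = UNIV"
proof (rule ccontr)
  assume "underlying_space \<sigma> \<noteq> UNIV"
  then obtain p where p: "p \<notin> underlying_space \<sigma>"
    by blast
  have line: "span {x} \<in> lines_through_origin" if "x \<noteq> 0" for x :: "real ^ 'n"
    using that by (simp add: lines_through_origin_def)
  define g where "g \<equiv> \<lambda>x. \<sigma> (span {x}) - p"
  \<comment> \<open>The point \<open>p\<close> is on the line through \<open>\<sigma> L\<close>
    parallel to \<open>L\<close> exactly when \<open>\<sigma> L - p\<close> lies in
    \<open>L\<close>.\<close>
  have g_span: "g x \<notin> span {x}" if "x \<noteq> 0" for x
  proof
    assume "g x \<in> span {x}"
    then have "p - \<sigma> (span {x}) \<in> span {x}"
      using span_neg [of "g x"] by (simp add: g_def)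
    then have "p \<in> (\<lambda>v. \<sigma> (span {x}) + v) ` span {x}"
      by (rule rev_image_eqI) simp
    then show False
      using p line [OF that] by (auto simp: underlying_space_def)
  qed
  have "continuous_map (top_of_set (UNIV - {0})) euclidean (\<sigma> \<circ> (\<lambda>x. span {x}))"
    using assms quotient_imp_continuous_map [OF quotient_map_projective_space]
    unfolding unoriented_kakeya_line_configuration_def by (rule continuous_map_compose [rotated])
  then have contg: "continuous_on (UNIV - {0}) g"
    by (auto simp: g_def comp_def intro!: continuous_intros)
  have "span {- x} = span {x}" for x :: "real ^ 'n"
    using span_neg [OF span_base, of "- x" "{- x}"] by (auto simp: span_eq span_base span_neg)
  then have g_even: "g (- x) = g x" for x
    by (simp add: g_def)
  \<comment> \<open>For unit \<open>x\<close> this is the component of \<open>g x\<close> orthogonal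
    to \<open>x\<close>. It is even because the two sign changes of \<open>x\<close> cancel.\<close>
  define f where "f \<equiv> \<lambda>x. g x - (g x \<bullet> x) *\<^sub>R x"
  have contf: "continuous_on (sphere 0 1) f"
    unfolding f_def by (intro continuous_intros continuous_on_subset [OF contg]) auto
  have f_even: "f (- x) = f x" for x
    by (simp add: f_def g_even)
  have f_nz: "f x \<noteq> 0" if "norm x = 1" for x
  proof
    assume "f x = 0"
    then have "g x = (g x \<bullet> x) *\<^sub>R x"
      by (simp add: f_def)
    then have "g x \<in> span {x}"
      by (metis span_base span_scale singletonI)
    then show False
      using g_span [of x] that by force
  qed
  have f_orth: "f x \<bullet> x = 0" if "norm x = 1" for x
    using that by (simp add: f_def inner_diff_left flip: power2_norm_eq_inner)
  \<comment> \<open>The component along \<open>x\<close> of a point of the segment is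
    \<open>1 - t\<close>. It vanishes only at the end \<open>f x\<close>, which is nonzero.\<close>
  have seg: "0 \<notin> closed_segment x (f x)" if "norm x = 1" for x
  proof
    assume "0 \<in> closed_segment x (f x)"
    then obtain t where t: "0 = (1 - t) *\<^sub>R x + t *\<^sub>R f x"
      by (auto simp: in_segment)
    then have "((1 - t) *\<^sub>R x + t *\<^sub>R f x) \<bullet> x = 0"
      by (metis inner_zero_left)
    then have "t = 1"
      using f_orth [OF that] that by (simp add: inner_add_left flip: power2_norm_eq_inner)
    then show False
      using t f_nz [OF that] by simp
  qed
  \<comment> \<open>In dimension 1 the only line through the origin is the whole space, so no point
    \<open>p\<close> can be missed. The degree argument needs a sphere of positive
    dimension.\<close>
  have "\<not> DIM(real ^ 'n) < 2"
  proof
    assume "DIM(real ^ 'n) < 2"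
    then have "DIM(real ^ 'n) = 1"
      using DIM_positive [where 'a = "real ^ 'n"] by linarith
    moreover obtain x :: "real ^ 'n" where "norm x = 1"
      using vector_choose_size [of 1] by auto
    ultimately have "dim (span {x}) = DIM(real ^ 'n)"
      by (cases "x = 0") auto
    then have "span {x} = UNIV"
      by (metis dim_eq_full span_span)
    then show False
      using g_span [of x] \<open>norm x = 1\<close> by (metis UNIV_I norm_zero zero_neq_one)
  qed
  then have "\<not> homotopic_with_canon (\<lambda>x. True) (sphere 0 1) (sphere 0 1) id (\<lambda>x. f x /\<^sub>R norm (f x))"
    by (intro even_sphere_map_not_homotopic_id) (auto simp: f_even)
  then show False
    using homotopic_normalized_sphere_map [OF continuous_on_id contf] seg by (simp add: id_def)
qed

theorem theorem1p1:
  shows "{K :: (real ^ 'n) set. unoriented_kakeya_line_set K} = {UNIV} \<and>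
         (\<forall>\<sigma> :: (real ^ 'n) set \<Rightarrow> real ^ 'n.
            unoriented_kakeya_line_configuration \<sigma> \<longrightarrow> underlying_space \<sigma> = UNIV)"
proof -
  \<comment> \<open>Some configuration must exist for \<open>UNIV\<close> to count as a line set; a
    constant map suffices.\<close>
  have "unoriented_kakeya_line_configuration (\<lambda>_ :: (real ^ 'n) set. 0)"
    by (simp add: unoriented_kakeya_line_configuration_def)
  then show ?thesis
    using underlying_space_eq_UNIV by (fastforce simp: unoriented_kakeya_line_set_def)
qed

end
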